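(* Let $d\ge 1$ be an integer and let $Z\subset D_1$ be a subset with $c_d(Z)=c>0$. Then each complex polynomial $P(x)$ of degree $d$ in one variable satisfies $$\max_{D_1}|P(x)|\ \le\ \Big(\frac{6e}{c}\Big)^d\ \max_{Z}|P(x)|.$$
   Context: $D_1\subset\mathbb{C}$ is the unit disk centered at $0$. For $Z\subset\mathbb{C}$ and an integer $d\ge1$, $c_d(Z)$ denotes the minimal (infimum of the) sum $r_1+\dots+r_d$ of the radii of $d$ disks in $\mathbb{C}$ covering $Z$. Here $e$ is the base of natural logarithms. A maximum over a set which need not be compact is read as a supremum. *)

theory Defs
  imports "HOL-Analysis.Analysis" "HOL-Computational_Algebra.Polynomial"
begin

(* The infimum is taken over a nonempty set, hence is meaningful, only if Z is bounded
   and d > 0 or Z is empty. Disks may coincide and may have radius 0; neither this nor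
   the choice of closed disks affects the infimum. *)
definition cover_radius :: "nat \<Rightarrow> complex set \<Rightarrow> real" where
  "cover_radius d Z =
     Inf {\<Sum>i<d. r i | (a :: nat \<Rightarrow> complex) (r :: nat \<Rightarrow> real).
            (\<forall>i<d. 0 \<le> r i) \<and> Z \<subseteq> (\<Union>i<d. cball (a i) (r i))}"

end

theory Submission
  imports Defs "HOL-Computational_Algebra.Fundamental_Theorem_Algebra"
begin

text \<open>The proof is Cartan's lemma. Given \<open>n\<close> roots and \<open>s > 0\<close>, remove greedily the roots in a
  disk of radius \<open>j * s\<close> containing at least \<open>j\<close> roots, \<open>j\<close> being as large as possible. Outside
  the removed disks with doubled radii, whose radii add up to at most \<open>2 * n * s\<close>, the \<open>k\<close>-th
  closest root has distance more than \<open>k * s\<close>, so the product of the distances is at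
  least \<open>s^n * n! \<ge> (s * n / e)^n\<close>. Apply this to the roots of modulus at most 2; each of them
  contributes at most 3 to \<open>|P|\<close> on the unit disk, and every other linear factor of \<open>P\<close> varies
  at most by the factor 3 there.\<close>

text \<open>Induction along strict inclusion: the heaviest disk is taken out with all its points,
  and the induction hypothesis handles the rest. Points are indexed by \<open>I\<close>, so that
  repeated roots count with multiplicity.\<close>

lemma cartan_disks:
  fixes z :: "'i \<Rightarrow> 'a::metric_space" and s :: real
  assumes "finite I" "s > 0"
  shows "\<exists>a r. (\<forall>i<card I. 0 \<le> r i) \<and> (\<Sum>i<card I. r i) \<le> 2 * s * card I \<and>
           (\<forall>w k. w \<notin> (\<Union>i<card I. cball (a i) (r i)) \<longrightarrow> k \<ge> 1 \<longrightarrow>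
              card {i\<in>I. dist w (z i) \<le> real k * s} < k)"
  using assms(1)
proof (induction I rule: finite_psubset_induct)
  case (psubset I)
  define heavy where "heavy j \<longleftrightarrow> j \<ge> 1 \<and> (\<exists>b. j \<le> card {i\<in>I. dist b (z i) \<le> real j * s})" for j
  show ?case
  proof (cases "\<exists>j. heavy j")
    \<comment> \<open>The centres tested by \<open>heavy\<close> range over the whole space, so
      without a heavy disk the counting bound holds at every \<open>w\<close>. Disks of radius 0
      with arbitrary centres then suffice.\<close>
    case False
    then have "card {i\<in>I. dist w (z i) \<le> real k * s} < k" if "k \<ge> 1" for w k
      using that unfolding heavy_def by (metis not_le)
    then show ?thesis
      using assms(2) by (intro exI[of _ "\<lambda>_. undefined :: 'a"], intro exI[of _ "\<lambda>_. 0 :: real"]) simp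
  next
    case True
    have "j \<le> card I" if "heavy j" for j
    proof -
      from that obtain b where "j \<le> card {i\<in>I. dist b (z i) \<le> real j * s}"
        unfolding heavy_def by blast
      also have "\<dots> \<le> card I"
        using psubset.hyps by (intro card_mono) auto
      finally show ?thesis .
    qed
    with True obtain j where j: "heavy j" and j_max: "\<And>k. heavy k \<Longrightarrow> k \<le> j"
      using Nat.ex_has_greatest_nat[of heavy _ "card I"] by blast
    then obtain b where b: "j \<le> card {i\<in>I. dist b (z i) \<le> real j * s}" and "j \<ge> 1"
      unfolding heavy_def by blast
    define S where "S = {i\<in>I. dist b (z i) \<le> real j * s}"
    have S: "S \<subseteq> I" "finite S" "j \<le> card S"
      using b psubset.hyps unfolding S_def by auto
    then have "S \<noteq> {}"
      using \<open>j \<ge> 1\<close> by auto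
    define m where "m = card (I - S)"
    have card_I: "card I = m + card S"
      using S psubset.hyps unfolding m_def
      by (metis card_Diff_subset card_mono le_add_diff_inverse2)
    have m_less: "m < card I"
      using card_I S(3) \<open>j \<ge> 1\<close> by simp
    have "I - S \<subset> I"
      using S \<open>S \<noteq> {}\<close> by auto
    from psubset.IH[OF this] obtain a r
      where r: "\<forall>i<m. 0 \<le> r i" and sum_r: "(\<Sum>i<m. r i) \<le> 2 * s * m"
        and light: "\<And>w k. w \<notin> (\<Union>i<m. cball (a i) (r i)) \<Longrightarrow> k \<ge> 1 \<Longrightarrow>
              card {i\<in>I - S. dist w (z i) \<le> real k * s} < k"
      unfolding m_def by blast
    define a' where "a' = a(m := b)"
    \<comment> \<open>The new disk goes to the index \<open>m\<close>, left free by the induction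
      hypothesis. Its radius is doubled so that points outside it are farther than
      \<open>j * s\<close> from all of \<open>S\<close>; the remaining indices are padded with
      radius 0.\<close>
    define r' where "r' i = (if i < m then r i else if i = m then 2 * j * s else 0)" for i
    have r': "\<forall>i<card I. 0 \<le> r' i"
      using r assms(2) by (auto simp: r'_def)
    have "(\<Sum>i<card I. r' i) = (\<Sum>i<Suc m. r' i)"
      using m_less by (intro sum.mono_neutral_right) (auto simp: r'_def)
    also have "\<dots> = (\<Sum>i<m. r i) + 2 * j * s"
      by (simp add: r'_def)
    \<comment> \<open>The at least \<open>j\<close> points of \<open>S\<close> pay for the new
      radius \<open>2 * j * s\<close>.\<close>
    also have "\<dots> \<le> 2 * s * m + 2 * s * card S"
      using sum_r S(3) assms(2) by (intro add_mono) auto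
    also have "\<dots> = 2 * s * card I"
      by (simp add: card_I algebra_simps)
    finally have sum_r': "(\<Sum>i<card I. r' i) \<le> 2 * s * card I" .
    have "card {i\<in>I. dist w (z i) \<le> real k * s} < k"
      if w: "w \<notin> (\<Union>i<card I. cball (a' i) (r' i))" and "k \<ge> 1" for w k
    proof (rule ccontr)
      assume *: "\<not> ?thesis"
      \<comment> \<open>A violation at \<open>w\<close> makes \<open>k\<close> heavy, hence
        \<open>k \<le> j\<close> by maximality. Then no point of \<open>S\<close> lies within
        \<open>k * s\<close> of \<open>w\<close>, so removing \<open>S\<close> leaves the count
        unchanged, against the induction hypothesis.\<close>
      then have "heavy k"
        using \<open>k \<ge> 1\<close> unfolding heavy_def by (auto simp: not_less)
      then have "real k * s \<le> real j * s"
        using j_max assms(2) by simp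
      moreover have "dist b w > 2 * (real j * s)"
        using w m_less by (force simp: a'_def r'_def)
      ultimately have far: "i \<notin> S" if "dist w (z i) \<le> real k * s" for i
        using that dist_triangle2[of b w "z i"] unfolding S_def by auto
      have "w \<notin> (\<Union>i<m. cball (a i) (r i))"
      proof
        assume "w \<in> (\<Union>i<m. cball (a i) (r i))"
        then obtain i where "i < m" "w \<in> cball (a i) (r i)"
          by blast
        then have "i < card I" "w \<in> cball (a' i) (r' i)"
          using m_less by (auto simp: a'_def r'_def)
        with w show False by blast
      qed
      from light[OF this \<open>k \<ge> 1\<close>]
      have "card {i\<in>I - S. dist w (z i) \<le> real k * s} < k" .
      moreover have "{i\<in>I - S. dist w (z i) \<le> real k * s} = {i\<in>I. dist w (z i) \<le> real k * s}"
        using far by auto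
      ultimately show False
        using * by simp
    qed
    with r' sum_r' show ?thesis
      by blast
  qed
qed

text \<open>The hypothesis with \<open>k = card I\<close> yields a point farther than
  \<open>card I * s\<close> from \<open>w\<close>. Splitting off its factor leaves a subset that
  inherits the hypothesis.\<close>

lemma prod_dist_ge_fact:
  fixes w :: "'a::metric_space" and s :: real
  assumes "finite I" "s > 0"
    and "\<And>k. k \<ge> 1 \<Longrightarrow> card {i\<in>I. dist w (z i) \<le> real k * s} < k"
  shows "s ^ card I * fact (card I) \<le> (\<Prod>i\<in>I. dist w (z i))"
  using assms(1,3)
proof (induction "card I" arbitrary: I)
  case 0
  then show ?case by simp
next
  case (Suc n)
  have "\<exists>i\<in>I. \<not> dist w (z i) \<le> real (Suc n) * s"
  proof (rule ccontr)
    assume "\<not> ?thesis"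
    then have "{i\<in>I. dist w (z i) \<le> real (Suc n) * s} = I"
      by auto
    then show False
      using Suc.prems(2)[of "Suc n"] Suc.hyps(2) by simp
  qed
  then obtain i where i: "i \<in> I" "real (Suc n) * s \<le> dist w (z i)"
    by fastforce
  have "card {i'\<in>I - {i}. dist w (z i') \<le> real k * s} < k" if "k \<ge> 1" for k
    using card_mono[of "{i'\<in>I. dist w (z i') \<le> real k * s}"
        "{i'\<in>I - {i}. dist w (z i') \<le> real k * s}"] Suc.prems that
    by (fastforce intro: le_less_trans)
  moreover have card: "card (I - {i}) = n"
    using Suc.hyps(2) i Suc.prems(1) by simp
  ultimately have "s ^ n * fact n \<le> (\<Prod>i\<in>I - {i}. dist w (z i))"
    using Suc.hyps(1)[of "I - {i}"] Suc.prems(1) by simp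
  then have "(real (Suc n) * s) * (s ^ n * fact n) \<le> dist w (z i) * (\<Prod>i\<in>I - {i}. dist w (z i))"
    using i assms(2) by (intro mult_mono) auto
  also have "\<dots> = (\<Prod>i\<in>I. dist w (z i))"
    using i Suc.prems(1) by (simp add: prod.remove)
  finally show ?case
    by (simp add: Suc.hyps(2)[symmetric] algebra_simps)
qed

text \<open>The quotient \<open>n ^ n / fact n\<close> is a single term of the exponential series at
  \<open>n\<close>, all of whose terms are nonnegative.\<close>

lemma power_self_le_exp_fact: "real n ^ n \<le> exp (real n) * fact n"
proof -
  have "(\<Sum>k\<in>{n}. real n ^ k /\<^sub>R fact k) \<le> (\<Sum>k. real n ^ k /\<^sub>R fact k)"
    by (intro sum_le_suminf summable_exp_generic) auto
  then show ?thesis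
    by (simp add: exp_def field_simps)
qed

lemma cover_radius_le:
  assumes "Z \<subseteq> (\<Union>i<d. cball (a i) (r i))" "\<forall>i<d. 0 \<le> r i"
  shows "cover_radius d Z \<le> (\<Sum>i<d. r i)"
  unfolding cover_radius_def
proof (rule cInf_lower)
  show "bdd_below {\<Sum>i<d. r i | (a :: nat \<Rightarrow> complex) r.
      (\<forall>i<d. 0 \<le> r i) \<and> Z \<subseteq> (\<Union>i<d. cball (a i) (r i))}"
    by (rule bdd_belowI[of _ 0]) (auto intro!: sum_nonneg)
qed (use assms in blast)

text \<open>Missing disks are supplied with radius 0. This serves the case where fewer than
  \<open>d\<close> roots lie near the unit disk.\<close>

lemma cover_radius_le_fewer:
  assumes "Z \<subseteq> (\<Union>i<n. cball (a i) (r i))" "\<forall>i<n. 0 \<le> r i" "n \<le> d"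
  shows "cover_radius d Z \<le> (\<Sum>i<n. r i)"
proof -
  define r' where "r' i = (if i < n then r i else 0)" for i
  have "Z \<subseteq> (\<Union>i<d. cball (a i) (r' i))"
  proof
    fix x assume "x \<in> Z"
    with assms(1) obtain i where "i < n" "x \<in> cball (a i) (r i)"
      by blast
    with assms(3) show "x \<in> (\<Union>i<d. cball (a i) (r' i))"
      by (intro UN_I[of i]) (auto simp: r'_def)
  qed
  then have "cover_radius d Z \<le> (\<Sum>i<d. r' i)"
    by (rule cover_radius_le) (use assms in \<open>auto simp: r'_def\<close>)
  also have "\<dots> = (\<Sum>i<n. r' i)"
    using assms(3) by (intro sum.mono_neutral_right) (auto simp: r'_def)
  finally show ?thesis
    by (simp add: r'_def)
qed

text \<open>Disks of total radius at most \<open>t\<close> cannot cover \<open>Z\<close>, because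
  \<open>t\<close> is strictly below the infimum; a point of \<open>Z\<close> that they miss is the
  required \<open>y\<close>.\<close>

lemma cartan_prod_ge:
  fixes z :: "'i \<Rightarrow> complex"
  assumes "finite I" "card I \<le> d" "0 < t" "t < cover_radius d Z"
  shows "\<exists>y\<in>Z. (t / (2 * exp 1)) ^ card I \<le> (\<Prod>i\<in>I. cmod (y - z i))"
proof -
  define n where "n = card I"
  \<comment> \<open>For \<open>n > 0\<close> the exceptional disks have total radius at most
    \<open>2 * s * n = t\<close>. For \<open>n = 0\<close> any positive value does.\<close>
  define s where "s = (if n = 0 then 1 else t / (2 * n))"
  have s: "s > 0" "2 * s * n \<le> t"
    using assms(3) by (auto simp: s_def)
  obtain a r where r: "\<forall>i<n. 0 \<le> r i" "(\<Sum>i<n. r i) \<le> 2 * s * n"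
    and far: "\<And>w k. w \<notin> (\<Union>i<n. cball (a i) (r i)) \<Longrightarrow> k \<ge> 1 \<Longrightarrow>
              card {i\<in>I. dist w (z i) \<le> real k * s} < k"
    using cartan_disks[OF assms(1) s(1), of z] unfolding n_def by blast
  have "\<not> Z \<subseteq> (\<Union>i<n. cball (a i) (r i))"
    using cover_radius_le_fewer[of Z a r n d] assms(2,4) r s unfolding n_def by fastforce
  then obtain y where y: "y \<in> Z" "y \<notin> (\<Union>i<n. cball (a i) (r i))"
    by blast
  have "(t / (2 * exp 1)) ^ n = (s / exp 1) ^ n * real n ^ n"
    by (cases "n = 0") (auto simp: s_def simp flip: power_mult_distrib)
  also have "\<dots> \<le> (s / exp 1) ^ n * (exp (real n) * fact n)"
    using s by (intro mult_left_mono power_self_le_exp_fact) auto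
  also have "\<dots> = s ^ n * fact n"
    by (simp add: power_divide exp_of_nat_mult[of n 1, simplified])
  also have "\<dots> \<le> (\<Prod>i\<in>I. dist y (z i))"
    unfolding n_def using prod_dist_ge_fact[OF assms(1) s(1) far[OF y(2)]] .
  finally show ?thesis
    using y(1) by (auto simp: n_def dist_norm)
qed

text \<open>The multiset of roots is listed, so that roots with multiplicity can be selected by sets
  of indices.\<close>

lemma poly_eq_prod_roots:
  fixes P :: "complex poly"
  shows "\<exists>z. \<forall>x. poly P x = lead_coeff P * (\<Prod>i<degree P. x - z i)"
proof (cases "P = 0")
  case False
  then obtain A where A: "size A = degree P" "P = smult (lead_coeff P) (\<Prod>x\<in>#A. [:-x, 1:])"
    using alg_closed_imp_factorization by blast
  obtain xs where xs: "mset xs = A"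
    using ex_mset by blast
  have "(\<Prod>x\<in>#A. [:-x, 1:]) = (\<Prod>i<degree P. [:- (xs ! i), 1:])"
    using A(1) xs
    by (metis (no_types, lifting) atLeast0LessThan mset_map prod.list_conv_set_nth prod_mset_prod_list
        length_map nth_map prod.cong size_mset lessThan_iff)
  then have "poly P x = lead_coeff P * (\<Prod>i<degree P. x - xs ! i)" for x
    by (subst A(2)) (simp add: poly_prod)
  then show ?thesis
    by blast
qed auto

theorem theorem2p1:
  fixes d :: nat and Z :: "complex set" and c :: real and P :: "complex poly"
  assumes "d \<ge> 1"
    and "Z \<subseteq> cball 0 1"
    and "cover_radius d Z = c"
    and "c > 0"
    and "degree P = d"
  shows "(SUP x\<in>cball 0 1. cmod (poly P x)) \<le> (6 * exp 1 / c) ^ d * (SUP x\<in>Z. cmod (poly P x))"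
proof -
  obtain z where P: "\<And>x. poly P x = lead_coeff P * (\<Prod>i<d. x - z i)"
    using poly_eq_prod_roots[of P] assms(5) by blast
  define I where "I = {i. i < d \<and> cmod (z i) \<le> 2}"
  define n where "n = card I"
  define M where "M = (SUP x\<in>Z. cmod (poly P x))"
  have I: "finite I" "I \<subseteq> {..<d}"
    by (auto simp: I_def)
  then have "n \<le> d"
    unfolding n_def using card_mono[of "{..<d}" I] by simp
  have norm_P: "cmod (poly P x) =
      cmod (lead_coeff P) * ((\<Prod>i\<in>I. cmod (x - z i)) * (\<Prod>i\<in>{..<d} - I. cmod (x - z i)))" for x
    using I by (simp add: P norm_mult prod_norm[symmetric] prod.subset_diff[of I "{..<d}"] mult.commute)
  have "compact ((\<lambda>x. cmod (poly P x)) ` cball 0 1)"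
    by (intro compact_continuous_image continuous_intros) auto
  then have bdd: "bdd_above ((\<lambda>x. cmod (poly P x)) ` Z)"
    using assms(2) by (meson bdd_above_mono bounded_imp_bdd_above compact_imp_bounded image_mono)
  have le_M: "cmod (poly P y) \<le> M" if "y \<in> Z" for y
    unfolding M_def by (rule cSUP_upper[OF that bdd])
  \<comment> \<open>The unit disk alone covers \<open>Z\<close>. The resulting bound
    \<open>c \<le> 1\<close> later allows the exponent \<open>n\<close> to be replaced by
    \<open>d\<close>.\<close>
  have "cover_radius d Z \<le> (\<Sum>i<1::nat. 1)"
    by (rule cover_radius_le_fewer[where a = "\<lambda>_. 0"]) (use assms in auto)
  then have "c \<le> 1"
    using assms(3) by simp
  have bound: "cmod (poly P x) * (t / (2 * exp 1)) ^ n \<le> 3 ^ d * M"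
    if x: "x \<in> cball 0 1" and t: "0 < t" "t < c" for x t
  proof -
    obtain y where y: "y \<in> Z" "(t / (2 * exp 1)) ^ n \<le> (\<Prod>i\<in>I. cmod (y - z i))"
      using cartan_prod_ge[of I d t Z z] I \<open>n \<le> d\<close> t assms(3) unfolding n_def by blast
    have y1: "cmod y \<le> 1"
      using y assms(2) by auto
    have "(\<Prod>i\<in>I. cmod (x - z i)) \<le> (\<Prod>i\<in>I. 3)"
    proof (rule prod_mono)
      fix i assume "i \<in> I"
      then show "0 \<le> cmod (x - z i) \<and> cmod (x - z i) \<le> 3"
        using norm_triangle_ineq4[of x "z i"] x by (auto simp: I_def)
    qed
    \<comment> \<open>For a root \<open>u\<close> with \<open>cmod u > 2\<close>, \<open>cmod (x -
      u) \<le> cmod u + 1 \<le> 3 * (cmod u - 1) \<le> 3 * cmod (y - u)\<close>.\<close>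
    moreover have "(\<Prod>i\<in>{..<d} - I. cmod (x - z i)) \<le> (\<Prod>i\<in>{..<d} - I. 3 * cmod (y - z i))"
    proof (rule prod_mono)
      fix i assume "i \<in> {..<d} - I"
      then show "0 \<le> cmod (x - z i) \<and> cmod (x - z i) \<le> 3 * cmod (y - z i)"
        using norm_triangle_ineq4[of x "z i"] norm_triangle_ineq2[of "z i" y] x y1
        by (auto simp: I_def norm_minus_commute)
    qed
    ultimately have "cmod (poly P x) * (t / (2 * exp 1)) ^ n
        \<le> (cmod (lead_coeff P) * ((\<Prod>i\<in>I. 3) * (\<Prod>i\<in>{..<d} - I. 3 * cmod (y - z i))))
          * (\<Prod>i\<in>I. cmod (y - z i))"
      unfolding norm_P using y(2) t by (intro mult_mono) (auto intro!: prod_nonneg mult_nonneg_nonneg)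
    also have "\<dots> = ((\<Prod>i\<in>I. 3) * (\<Prod>i\<in>{..<d} - I. 3)) * cmod (poly P y)"
      unfolding norm_P by (simp add: prod.distrib mult_ac)
    also have "(\<Prod>i\<in>I. 3) * (\<Prod>i\<in>{..<d} - I. 3) = (3 ^ d :: real)"
      using I prod.subset_diff[of I "{..<d}" "\<lambda>_. 3 :: real"] by (simp add: mult.commute)
    finally show ?thesis
      using le_M[OF y(1)] by (smt (verit) mult_left_mono zero_le_power)
  qed
  have "cmod (poly P x) \<le> (6 * exp 1 / c) ^ d * M" if x: "x \<in> cball 0 1" for x
  proof -
    \<comment> \<open>The point \<open>y\<close> depends on \<open>t\<close>, but the bound no
      longer mentions it, so \<open>t\<close> may tend to \<open>c\<close> from the left.\<close>
    have "((\<lambda>t. cmod (poly P x) * (t / (2 * exp 1)) ^ n) \<longlongrightarrow>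
        cmod (poly P x) * (c / (2 * exp 1)) ^ n) (at_left c)"
      by (intro tendsto_intros) auto
    moreover have "\<forall>\<^sub>F t in at_left c. cmod (poly P x) * (t / (2 * exp 1)) ^ n \<le> 3 ^ d * M"
      using eventually_at_left_real[OF assms(4)] by eventually_elim (use bound x in auto)
    ultimately have "cmod (poly P x) * (c / (2 * exp 1)) ^ n \<le> 3 ^ d * M"
      by (rule tendsto_upperbound) auto
    \<comment> \<open>The base is at most 1, so raising the exponent from \<open>n\<close> to
      \<open>d\<close> only decreases the power.\<close>
    moreover have "(c / (2 * exp 1)) ^ d \<le> (c / (2 * exp 1)) ^ n"
      using \<open>c \<le> 1\<close> assms(4) \<open>n \<le> d\<close> exp_ge_add_one_self[of 1]
      by (intro power_decreasing) (auto simp: divide_le_eq)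
    ultimately have "cmod (poly P x) * (c / (2 * exp 1)) ^ d \<le> 3 ^ d * M"
      by (meson mult_left_mono norm_ge_zero order_trans)
    then have "cmod (poly P x) \<le> 3 ^ d * M / (c / (2 * exp 1)) ^ d"
      using assms(4) by (simp add: pos_le_divide_eq)
    also have "\<dots> = (3 / (c / (2 * exp 1))) ^ d * M"
      by (simp only: power_divide times_divide_eq_left)
    also have "3 / (c / (2 * exp 1)) = 6 * exp 1 / c"
      by simp
    finally show ?thesis .
  qed
  then show ?thesis
    unfolding M_def by (intro cSUP_least) auto
qed

end
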